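(* Let $K(\mathcal{H})$ be a finite dimensional $C^*$-algebra, let $\mathcal{E}$ be a full Hilbert $K(\mathcal{H})$-module, and let $x, y \in \mathcal{E}$. Then the following statements are equivalent: (i) $\theta_{x,x} \| \theta_{y,y}$; (ii) there exist a basic vector $v$ in $\mathcal{E}$, with $\langle v,v\rangle=\xi\otimes\xi$ for a unit vector $\xi\in\mathcal{H}$, and some $\lambda\in\mathbb{T}$ such that $$[\langle v, x \rangle \langle x, y \rangle \langle y , v\rangle \xi, \xi ] =\lambda \| x\|^2 \| y\|^2;$$ (iii) $\| \langle x, y \rangle\| = \| x\|\| y\|$.
   Context: $(\mathcal{H}, [\cdot,\cdot])$ is a complex Hilbert space and $K(\mathcal{H})$ is the $C^*$-algebra of compact linear operators on $\mathcal{H}$. A (left) Hilbert $\mathcal{A}$-module over a $C^*$-algebra $\mathcal{A}$ is a left $\mathcal{A}$-module with an $\mathcal{A}$-valued inner product $\langle\cdot,\cdot\rangle$, linear in the first variable and conjugate linear in the second, such that $\langle tx,y\rangle=t\langle x,y\rangle$ for $t\in\mathcal{A}$, $\langle x,y\rangle^*=\langle y,x\rangle$, $\langle x,x\rangle\ge 0$ with equality iff $x=0$, and which is complete for the norm $\|x\|=\|\langle x,x\rangle\|^{1/2}$. It is full if $\mathrm{span}\{\langle x,y\rangle: x,y\in\mathcal{E}\}$ is dense in $\mathcal{A}$. For $x,y\in\mathcal{E}$, $\theta_{x,y}:\mathcal{E}\to\mathcal{E}$ is $\theta_{x,y}(z)=\langle z,y\rangle x$, considered in the space $\mathcal{L}(\mathcal{E})$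 of adjointable maps with the operator norm. For $\xi,\eta\in\mathcal{H}$, $\xi\otimes\eta$ is the operator $\nu\mapsto[\nu,\eta]\xi$. A projection $e\in K(\mathcal{H})$ is minimal if $eB(\mathcal{H})e=\mathbb{C}e$, equivalently $e=\xi\otimes\xi$ for a unit vector $\xi\in\mathcal{H}$. A vector $x\in\mathcal{E}$ is basic if $\langle x,x\rangle$ is a minimal projection. Norm-parallelism: for elements $x,y$ of a complex normed space, $x\|y$ means $\|x+\lambda y\|=\|x\|+\|y\|$ for some $\lambda\in\mathbb{T}=\{\alpha\in\mathbb{C}:|\alpha|=1\}$. *)

theory Defs
  imports "HOL-Analysis.Analysis"
begin

section \<open>Complex normed spaces and Hilbert spaces\<close>

class complex_vector = real_vector +
  fixes scaleC :: "complex \<Rightarrow> 'a \<Rightarrow> 'a"  (infixr "*\<^sub>C" 75)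
  assumes scaleC_add_right: "a *\<^sub>C (x + y) = a *\<^sub>C x + a *\<^sub>C y"
    and scaleC_add_left: "(a + b) *\<^sub>C x = a *\<^sub>C x + b *\<^sub>C x"
    and scaleC_scaleC: "a *\<^sub>C b *\<^sub>C x = (a * b) *\<^sub>C x"
    and scaleC_one: "1 *\<^sub>C x = x"
    and scaleR_scaleC: "r *\<^sub>R x = complex_of_real r *\<^sub>C x"

class complex_normed_vector = complex_vector + real_normed_vector +
  assumes norm_scaleC: "norm (a *\<^sub>C x) = cmod a * norm x"

text \<open>Linear in the first variable and conjugate linear in the second.  The last axiom
  includes positive definiteness.\<close>

class complex_hilbert = complex_normed_vector + banach +
  fixes cinner :: "'a \<Rightarrow> 'a \<Rightarrow> complex"
  assumes cinner_commute: "cinner x y = cnj (cinner y x)"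
    and cinner_add_left: "cinner (x + y) z = cinner x z + cinner y z"
    and cinner_scaleC_left: "cinner (a *\<^sub>C x) y = a * cinner x y"
    and cinner_self: "cinner x x = complex_of_real ((norm x)\<^sup>2)"

global_interpretation complex_vector: vector_space "scaleC :: complex \<Rightarrow> 'a \<Rightarrow> 'a::complex_vector"
  by unfold_locales
    (rule scaleC_add_right scaleC_add_left scaleC_scaleC scaleC_one)+

lemma bounded_linear_scaleC:
  "bounded_linear (\<lambda>x. a *\<^sub>C (x :: 'a::complex_normed_vector))"
proof (rule bounded_linear_intro[where K = "cmod a"])
  show "a *\<^sub>C (r *\<^sub>R x) = r *\<^sub>R (a *\<^sub>C x)" for r and x :: 'a
    by (simp add: scaleR_scaleC scaleC_scaleC mult.commute)
qed (simp_all add: scaleC_add_right norm_scaleC mult.commute)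

instantiation blinfun :: (real_normed_vector, complex_normed_vector) complex_normed_vector
begin

lift_definition scaleC_blinfun :: "complex \<Rightarrow> 'a \<Rightarrow>\<^sub>L 'b \<Rightarrow> 'a \<Rightarrow>\<^sub>L 'b"
  is "\<lambda>a f x. a *\<^sub>C f x"
  by (rule bounded_linear_compose[OF bounded_linear_scaleC])

instance
proof
  fix a b :: complex and f g :: "'a \<Rightarrow>\<^sub>L 'b" and r :: real
  show "a *\<^sub>C (f + g) = a *\<^sub>C f + a *\<^sub>C g"
    by transfer (simp add: scaleC_add_right)
  show "(a + b) *\<^sub>C f = a *\<^sub>C f + b *\<^sub>C f"
    by transfer (simp add: scaleC_add_left)
  show "a *\<^sub>C b *\<^sub>C f = (a * b) *\<^sub>C f"
    by transfer (simp add: scaleC_scaleC)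
  show "1 *\<^sub>C f = f"
    by transfer (simp add: scaleC_one)
  show "r *\<^sub>R f = complex_of_real r *\<^sub>C f"
    by transfer (simp add: scaleR_scaleC)
  show "norm (a *\<^sub>C f) = cmod a * norm f"
  proof transfer
    fix a :: complex and f :: "'a \<Rightarrow> 'b"
    assume "bounded_linear f"
    then have "onorm (\<lambda>x. cmod a *\<^sub>R f x) = cmod a * onorm f"
      by (simp add: onorm_scaleR)
    then show "onorm (\<lambda>x. a *\<^sub>C f x) = cmod a * onorm f"
      by (simp add: onorm_def norm_scaleC)
  qed
qed

end

lemma cinner_zero_left [simp]: "cinner 0 (y::'a::complex_hilbert) = 0"
  using cinner_add_left[of 0 0 y] by simp

lemma cinner_add_right: "cinner (x::'a::complex_hilbert) (y + z) = cinner x y + cinner x z"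
  by (metis cinner_commute cinner_add_left complex_cnj_add)

lemma cinner_scaleC_right: "cinner (x::'a::complex_hilbert) (a *\<^sub>C y) = cnj a * cinner x y"
  by (metis cinner_commute cinner_scaleC_left complex_cnj_mult)

text \<open>Cauchy--Schwarz for semi-inner products on a complex vector space, used both for
  Hilbert spaces and for Hilbert modules.\<close>

lemma semi_inner_cauchy_schwarz:
  fixes B :: "'a::complex_vector \<Rightarrow> 'a \<Rightarrow> complex"
  assumes comm: "\<And>x y. B x y = cnj (B y x)"
    and add: "\<And>x y z. B (x + y) z = B x z + B y z"
    and scale: "\<And>a x y. B (a *\<^sub>C x) y = a * B x y"
    and pos: "\<And>x. Re (B x x) \<ge> 0"
  shows "(cmod (B x y))\<^sup>2 \<le> Re (B x x) * Re (B y y)"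
proof -
  have addr: "B x (y + z) = B x y + B x z" for x y z
    by (metis comm add complex_cnj_add)
  have scaler: "B x (a *\<^sub>C y) = cnj a * B x y" for a x y
    by (metis comm scale complex_cnj_mult)
  have real: "B x x = complex_of_real (Re (B x x))" for x
    using comm[of x x] by (simp add: complex_eq_iff)
  define p q n where "p = Re (B x x)" and "q = Re (B y y)" and "n = (cmod (B x y))\<^sup>2"
  have quad: "0 \<le> p + 2 * s * n + s\<^sup>2 * n * q" for s :: real
  proof -
    define a where "a = complex_of_real s * B x y"
    have "B (x + a *\<^sub>C y) (x + a *\<^sub>C y)
        = B x x + cnj a * B x y + (a * cnj (B x y) + a * cnj a * B y y)"
      using comm[of y x] by (simp add: add addr scale scaler algebra_simps)
    also have "\<dots> = complex_of_real p + 2 * complex_of_real s * (B x y * cnj (B x y))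
        + (complex_of_real s)\<^sup>2 * (B x y * cnj (B x y)) * complex_of_real q"
      using real[of x] real[of y]
      by (simp add: a_def p_def q_def power2_eq_square algebra_simps)
    also have "\<dots> = complex_of_real (p + 2 * s * n + s\<^sup>2 * n * q)"
      unfolding n_def of_real_add of_real_mult complex_norm_square by simp
    finally show ?thesis
      using pos[of "x + a *\<^sub>C y"] by simp
  qed
  have n0: "n \<ge> 0" and q0: "q \<ge> 0" and p0: "p \<ge> 0"
    by (auto simp: n_def q_def p_def pos)
  have "n \<le> p * q"
  proof (cases "q = 0")
    case True
    have "n = 0"
    proof (rule ccontr)
      assume "n \<noteq> 0"
      then show False
        using quad[of "- (p + 1) / (2 * n)"] True p0 by (simp add: field_simps)
    qed
    then show ?thesis using True by simp
  next
    case False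
    have "0 \<le> p - n / q"
      using quad[of "- 1 / q"] False by (simp add: power2_eq_square field_simps)
    then show ?thesis
      using False q0 by (simp add: field_simps)
  qed
  then show ?thesis by (simp add: n_def p_def q_def)
qed

lemma cinner_cauchy_schwarz:
  "cmod (cinner x (y::'a::complex_hilbert)) \<le> norm x * norm y"
proof -
  have "(cmod (cinner x y))\<^sup>2 \<le> Re (cinner x x) * Re (cinner y y)"
    by (rule semi_inner_cauchy_schwarz)
      (rule cinner_commute cinner_add_left cinner_scaleC_left | simp add: cinner_self)+
  then have "(cmod (cinner x y))\<^sup>2 \<le> (norm x * norm y)\<^sup>2"
    by (simp add: cinner_self power_mult_distrib)
  then show ?thesis
    by (rule power2_le_imp_le) simp
qed

section \<open>Operators on a Hilbert space\<close>

text \<open>Elements of \<^typ>\<open>'h \<Rightarrow>\<^sub>L 'h\<close> are only real-linear, so complex linearity is imposed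
  separately.  The norm of \<^typ>\<open>'h \<Rightarrow>\<^sub>L 'h\<close> is the operator norm.\<close>

definition bounded_operators :: "('h::complex_hilbert \<Rightarrow>\<^sub>L 'h) set" where
  "bounded_operators = {t :: 'h \<Rightarrow>\<^sub>L 'h. \<forall>a \<xi>. t (a *\<^sub>C \<xi>) = a *\<^sub>C t \<xi>}"

definition compact_operators :: "('h::complex_hilbert \<Rightarrow>\<^sub>L 'h) set" where
  "compact_operators = {t \<in> bounded_operators. compact (closure (blinfun_apply t ` cball 0 1))}"

definition is_adjoint :: "('h::complex_hilbert \<Rightarrow>\<^sub>L 'h) \<Rightarrow> ('h \<Rightarrow>\<^sub>L 'h) \<Rightarrow> bool" where
  "is_adjoint s t \<longleftrightarrow> (\<forall>\<xi> \<eta>. cinner (s \<xi>) \<eta> = cinner \<xi> (t \<eta>))"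

definition positive_operator :: "('h::complex_hilbert \<Rightarrow>\<^sub>L 'h) \<Rightarrow> bool" where
  "positive_operator t \<longleftrightarrow> (\<forall>\<xi>. cinner (t \<xi>) \<xi> \<in> \<real> \<and> Re (cinner (t \<xi>) \<xi>) \<ge> 0)"

definition rank_one :: "'h::complex_hilbert \<Rightarrow> 'h \<Rightarrow> 'h \<Rightarrow>\<^sub>L 'h" where
  "rank_one \<xi> \<eta> = Blinfun (\<lambda>\<nu>. cinner \<nu> \<eta> *\<^sub>C \<xi>)"

lemma rank_one_apply [simp]: "rank_one \<xi> \<eta> \<nu> = cinner \<nu> \<eta> *\<^sub>C \<xi>"
proof -
  have "bounded_linear (\<lambda>\<nu>. cinner \<nu> \<eta> *\<^sub>C \<xi>)"
  proof (rule bounded_linear_intro[where K = "norm \<eta> * norm \<xi>"])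
    fix \<mu> \<nu> :: 'a and r :: real
    show "cinner (\<mu> + \<nu>) \<eta> *\<^sub>C \<xi> = cinner \<mu> \<eta> *\<^sub>C \<xi> + cinner \<nu> \<eta> *\<^sub>C \<xi>"
      by (simp add: cinner_add_left scaleC_add_left)
    show "cinner (r *\<^sub>R \<nu>) \<eta> *\<^sub>C \<xi> = r *\<^sub>R (cinner \<nu> \<eta> *\<^sub>C \<xi>)"
      by (simp add: scaleR_scaleC cinner_scaleC_left scaleC_scaleC)
    show "norm (cinner \<nu> \<eta> *\<^sub>C \<xi>) \<le> norm \<nu> * (norm \<eta> * norm \<xi>)"
      using mult_right_mono[OF cinner_cauchy_schwarz[of \<nu> \<eta>] norm_ge_zero[of \<xi>]]
      by (simp add: norm_scaleC mult.assoc)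
  qed
  then show ?thesis
    by (simp add: rank_one_def bounded_linear_Blinfun_apply)
qed

text \<open>The zero projection satisfies the condition on corners and has to be excluded explicitly.\<close>

definition minimal_projection :: "('h::complex_hilbert \<Rightarrow>\<^sub>L 'h) \<Rightarrow> bool" where
  "minimal_projection e \<longleftrightarrow>
     e \<in> compact_operators \<and> e o\<^sub>L e = e \<and> is_adjoint e e \<and> e \<noteq> 0 \<and>
     {e o\<^sub>L t o\<^sub>L e | t. t \<in> bounded_operators} = range (\<lambda>a::complex. a *\<^sub>C e)"

definition norm_parallel :: "'a::complex_normed_vector \<Rightarrow> 'a \<Rightarrow> bool" where
  "norm_parallel x y \<longleftrightarrow> (\<exists>\<mu>::complex. cmod \<mu> = 1 \<and> norm (x + \<mu> *\<^sub>C y) = norm x + norm y)"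

section \<open>Hilbert modules over the compact operators\<close>

text \<open>The module action \<open>act\<close> is only constrained on compact operators.  The norm of the
  module type is required to be the one induced by the operator-valued inner product, so that
  completeness is the type class \<^class>\<open>banach\<close>.\<close>

locale hilbert_module =
  fixes act :: "('h::complex_hilbert \<Rightarrow>\<^sub>L 'h) \<Rightarrow> 'e::{complex_normed_vector, banach} \<Rightarrow> 'e"
    and ip :: "'e \<Rightarrow> 'e \<Rightarrow> ('h \<Rightarrow>\<^sub>L 'h)"
  assumes act_add_right: "t \<in> compact_operators \<Longrightarrow> act t (x + y) = act t x + act t y"
    and act_add_left: "\<lbrakk>s \<in> compact_operators; t \<in> compact_operators\<rbrakk> \<Longrightarrow>
      act (s + t) x = act s x + act t x"
    and act_compose: "\<lbrakk>s \<in> compact_operators; t \<in> compact_operators\<rbrakk> \<Longrightarrow>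
      act (s o\<^sub>L t) x = act s (act t x)"
    and act_scaleC_left: "t \<in> compact_operators \<Longrightarrow> act (a *\<^sub>C t) x = a *\<^sub>C act t x"
    and act_scaleC_right: "t \<in> compact_operators \<Longrightarrow> act t (a *\<^sub>C x) = a *\<^sub>C act t x"
    and ip_compact: "ip x y \<in> compact_operators"
    and ip_add_left: "ip (x + y) z = ip x z + ip y z"
    and ip_scaleC_left: "ip (a *\<^sub>C x) y = a *\<^sub>C ip x y"
    and ip_add_right: "ip x (y + z) = ip x y + ip x z"
    and ip_scaleC_right: "ip x (a *\<^sub>C y) = cnj a *\<^sub>C ip x y"
    and ip_act_left: "t \<in> compact_operators \<Longrightarrow> ip (act t x) y = t o\<^sub>L ip x y"
    and ip_adjoint: "is_adjoint (ip x y) (ip y x)"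
    and ip_positive: "positive_operator (ip x x)"
    and ip_eq_zero_iff: "ip x x = 0 \<longleftrightarrow> x = 0"
    and norm_eq_sqrt_ip: "norm x = sqrt (norm (ip x x))"

definition full_module :: "('e \<Rightarrow> 'e \<Rightarrow> ('h::complex_hilbert \<Rightarrow>\<^sub>L 'h)) \<Rightarrow> bool" where
  "full_module ip \<longleftrightarrow> compact_operators \<subseteq> closure (complex_vector.span {ip x y | x y. True})"

definition basic_vector :: "('e \<Rightarrow> 'e \<Rightarrow> ('h::complex_hilbert \<Rightarrow>\<^sub>L 'h)) \<Rightarrow> 'e \<Rightarrow> bool" where
  "basic_vector ip v \<longleftrightarrow> minimal_projection (ip v v)"

text \<open>The adjointable maps carry the operator norm, i.e. the norm of the ambient type
  \<^typ>\<open>'e \<Rightarrow>\<^sub>L 'e\<close>.  Lemma \<open>theta_apply\<close> shows that the map below is bounded in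
  every Hilbert module, so that \<^const>\<open>Blinfun\<close> is applied inside its domain.\<close>

definition theta ::
  "(('h::complex_hilbert \<Rightarrow>\<^sub>L 'h) \<Rightarrow> 'e \<Rightarrow> 'e) \<Rightarrow> ('e \<Rightarrow> 'e \<Rightarrow> ('h \<Rightarrow>\<^sub>L 'h)) \<Rightarrow>
     'e::{complex_normed_vector, banach} \<Rightarrow> 'e \<Rightarrow> 'e \<Rightarrow>\<^sub>L 'e" where
  "theta act ip x y = Blinfun (\<lambda>z. act (ip z y) x)"

context hilbert_module
begin

lemma norm_power2: "(norm x)\<^sup>2 = norm (ip x x)"
  by (simp add: norm_eq_sqrt_ip)

lemma ip_quadratic_bound: "Re (cinner (ip x x \<xi>) \<xi>) \<le> (norm x)\<^sup>2 * (norm \<xi>)\<^sup>2"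
proof -
  have "Re (cinner (ip x x \<xi>) \<xi>) \<le> cmod (cinner (ip x x \<xi>) \<xi>)"
    by (rule complex_Re_le_cmod)
  also have "\<dots> \<le> norm (ip x x \<xi>) * norm \<xi>"
    by (rule cinner_cauchy_schwarz)
  also have "\<dots> \<le> (norm (ip x x) * norm \<xi>) * norm \<xi>"
    by (rule mult_right_mono[OF norm_blinfun norm_ge_zero])
  finally show ?thesis
    by (simp add: norm_power2 power2_eq_square[of "norm \<xi>"] mult.assoc)
qed

lemma norm_ip_le: "norm (ip x y) \<le> norm x * norm y"
proof (rule norm_blinfun_bound)
  fix \<xi> :: 'h
  let ?t = "ip y x" and ?\<eta> = "ip x y \<xi>"
  have adj: "cinner (?t \<mu>) \<nu> = cinner \<mu> (ip x y \<nu>)" for \<mu> \<nu>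
    using ip_adjoint[of y x] by (simp add: is_adjoint_def)
  have cs: "(cmod (cinner (ip u w \<xi>) \<xi>))\<^sup>2
      \<le> Re (cinner (ip u u \<xi>) \<xi>) * Re (cinner (ip w w \<xi>) \<xi>)" for u w
  proof (rule semi_inner_cauchy_schwarz[where B = "\<lambda>u w. cinner (ip u w \<xi>) \<xi>"])
    fix u w z :: 'e and a :: complex
    show "cinner (ip u w \<xi>) \<xi> = cnj (cinner (ip w u \<xi>) \<xi>)"
      using ip_adjoint[of u w] cinner_commute[of \<xi> "ip w u \<xi>"] by (simp add: is_adjoint_def)
    show "cinner (ip (u + w) z \<xi>) \<xi> = cinner (ip u z \<xi>) \<xi> + cinner (ip w z \<xi>) \<xi>"
      by (simp add: ip_add_left blinfun.add_left cinner_add_left)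
    show "cinner (ip (a *\<^sub>C u) w \<xi>) \<xi> = a * cinner (ip u w \<xi>) \<xi>"
      by (simp add: ip_scaleC_left scaleC_blinfun.rep_eq cinner_scaleC_left)
    show "0 \<le> Re (cinner (ip u u \<xi>) \<xi>)"
      using ip_positive[of u] by (simp add: positive_operator_def)
  qed
  have lhs: "cinner (ip (act ?t x) y \<xi>) \<xi> = complex_of_real ((norm ?\<eta>)\<^sup>2)"
    by (simp add: ip_act_left ip_compact adj cinner_self)
  have sq: "ip (act ?t x) (act ?t x) \<xi> = ?t (ip x (act ?t x) \<xi>)"
    by (simp add: ip_act_left ip_compact)
  have "cinner (ip (act ?t x) (act ?t x) \<xi>) \<xi> = cinner (ip x (act ?t x) \<xi>) ?\<eta>"
    by (simp add: sq adj)
  also have "\<dots> = cinner \<xi> (ip (act ?t x) x ?\<eta>)"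
    using ip_adjoint[of x "act ?t x"] by (simp add: is_adjoint_def)
  also have "\<dots> = cinner \<xi> (?t (ip x x ?\<eta>))"
    by (simp add: ip_act_left ip_compact)
  also have "\<dots> = cinner ?\<eta> (ip x x ?\<eta>)"
    using ip_adjoint[of x y] by (simp add: is_adjoint_def)
  also have "\<dots> = cinner (ip x x ?\<eta>) ?\<eta>"
    using ip_adjoint[of x x] by (simp add: is_adjoint_def)
  finally have "Re (cinner (ip (act ?t x) (act ?t x) \<xi>) \<xi>) \<le> (norm x)\<^sup>2 * (norm ?\<eta>)\<^sup>2"
    using ip_quadratic_bound[of x ?\<eta>] by simp
  then have "((norm ?\<eta>)\<^sup>2)\<^sup>2 \<le> ((norm x)\<^sup>2 * (norm ?\<eta>)\<^sup>2) * ((norm y)\<^sup>2 * (norm \<xi>)\<^sup>2)"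
    using cs[of "act ?t x" y] ip_quadratic_bound[of y \<xi>] ip_positive[of "y"]
    unfolding lhs positive_operator_def
    by (simp only: norm_of_real abs_power2 abs_norm_cancel)
      (smt (verit, best) mult_mono mult_nonneg_nonneg zero_le_power2)
  then have "(norm ?\<eta>)\<^sup>2 * (norm ?\<eta>)\<^sup>2 \<le> (norm ?\<eta>)\<^sup>2 * (norm x * norm y * norm \<xi>)\<^sup>2"
    by (simp add: power_mult_distrib power2_eq_square mult_ac)
  then have "(norm ?\<eta>)\<^sup>2 \<le> (norm x * norm y * norm \<xi>)\<^sup>2"
    by (cases "?\<eta> = 0") (simp, simp only: mult_le_cancel_left_pos zero_less_power zero_less_norm_iff not_False_eq_True)
  then show "norm ?\<eta> \<le> norm x * norm y * norm \<xi>"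
    by (rule power2_le_imp_le) simp
qed simp

lemma norm_act_le:
  assumes K: "t \<in> compact_operators"
  shows "norm (act t x) \<le> norm t * norm x"
proof -
  have "norm (act t x) * norm (act t x) = norm (ip (act t x) (act t x))"
    using norm_power2[of "act t x"] by (simp add: power2_eq_square)
  also have "\<dots> = norm (t o\<^sub>L ip x (act t x))"
    by (simp add: ip_act_left K)
  also have "\<dots> \<le> norm t * norm (ip x (act t x))"
    by (rule norm_blinfun_compose)
  also have "\<dots> \<le> norm t * (norm x * norm (act t x))"
    by (rule mult_left_mono[OF norm_ip_le norm_ge_zero])
  finally have "norm (act t x) * norm (act t x) \<le> (norm t * norm x) * norm (act t x)"
    by (simp add: mult.assoc)
  then show ?thesis
    by (cases "act t x = 0") (simp_all add: mult_le_cancel_right)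
qed

lemma theta_apply: "theta act ip x y z = act (ip z y) x"
proof -
  have "bounded_linear (\<lambda>z. act (ip z y) x)"
  proof (rule bounded_linear_intro[where K = "norm y * norm x"])
    fix u w :: 'e and r :: real
    show "act (ip (u + w) y) x = act (ip u y) x + act (ip w y) x"
      by (simp add: ip_add_left act_add_left ip_compact)
    show "act (ip (r *\<^sub>R u) y) x = r *\<^sub>R act (ip u y) x"
      by (simp add: scaleR_scaleC ip_scaleC_left act_scaleC_left ip_compact)
    have "norm (act (ip u y) x) \<le> norm (ip u y) * norm x"
      by (rule norm_act_le[OF ip_compact])
    also have "\<dots> \<le> (norm u * norm y) * norm x"
      by (rule mult_right_mono[OF norm_ip_le norm_ge_zero])
    finally show "norm (act (ip u y) x) \<le> norm u * (norm y * norm x)"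
      by (simp add: mult.assoc)
  qed
  then show ?thesis
    by (simp add: theta_def bounded_linear_Blinfun_apply)
qed

end

end

theory Submission
  imports Defs
begin

text \<open>Everything is compared with the norm equality \<open>\<parallel>\<langle>x, y\<rangle>\<parallel> = \<parallel>x\<parallel>\<parallel>y\<parallel>\<close>, and the picture behind the
  proof is the model in which module elements are operators into the Hilbert space,
  \<open>\<langle>x, y\<rangle> = x y\<^sup>*\<close> and \<open>\<theta>\<^bsub>x,x\<^esub>\<close> is right multiplication by \<open>x\<^sup>* x\<close>.  There all three
  conditions say that \<open>x\<^sup>* x\<close> and \<open>y\<^sup>* y\<close> have a common unit eigenvector for their largest
  eigenvalues, and the basic vector \<open>v\<close> encodes this eigenvector.

  Suppose first that the norm equality holds and \<open>x, y \<noteq> 0\<close>.  Being the adjoint of a compact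
  operator, \<open>\<langle>x, y\<rangle>\<close> attains its norm at some unit vector \<open>h\<close>
  (\<open>adjoint_of_compact_attains_norm\<close>).  Equality in \<open>\<langle>x, y\<rangle>\<^sup>*\<langle>x, y\<rangle> \<le> \<parallel>x\<parallel>\<^sup>2\<langle>y, y\<rangle>\<close> at \<open>h\<close> makes
  \<open>h\<close> an eigenvector of \<open>\<langle>y, y\<rangle>\<close> for the value \<open>\<parallel>y\<parallel>\<^sup>2\<close>, so \<open>v = \<parallel>y\<parallel>\<^sup>-\<^sup>1 (h \<otimes> h) y\<close> satisfies
  \<open>\<langle>v, v\<rangle> = h \<otimes> h\<close> (\<open>adapted_basic_vector\<close>).  Direct computation with \<open>v\<close> gives the identity
  with \<open>\<lambda> = 1\<close>, and shows that \<open>\<theta>\<^bsub>x,x\<^esub> + \<theta>\<^bsub>y,y\<^esub>\<close> already reaches the norm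
  \<open>\<parallel>x\<parallel>\<^sup>2 + \<parallel>y\<parallel>\<^sup>2\<close> on \<open>v\<close>.  Conversely the identity for \<open>v\<close> forces the norm equality by
  Cauchy--Schwarz (\<open>norm_ip_eq_if_basic_vector\<close>).

  The remaining implication, from parallelism to the norm equality, is proved by contraposition and
  quantitatively: \<open>\<theta>\<^bsub>x,x\<^esub> + \<mu> \<theta>\<^bsub>y,y\<^esub>\<close> is bounded by the largest eigenvalue of the real
  two-by-two matrix with diagonal \<open>\<parallel>x\<parallel>\<^sup>2, \<parallel>y\<parallel>\<^sup>2\<close> and off-diagonal entry \<open>\<parallel>\<langle>x, y\<rangle>\<parallel>\<close>
  (\<open>norm_theta_sum_le\<close>), and that eigenvalue stays below the trace as soon as the determinant
  is positive.  Since this is an estimate, no vector at which the norm of the sum is attained has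
  to be found in the possibly infinite-dimensional module.

  When \<open>x\<close> or \<open>y\<close> vanishes, the conditions hold trivially except that a basic vector must exist;
  fullness supplies a non-zero element \<open>w\<close>, and the construction applies to the pair \<open>(w, w)\<close>.\<close>

section \<open>Operators on the Hilbert space\<close>

lemma cinner_diff_left: "cinner (x - y) (z::'a::complex_hilbert) = cinner x z - cinner y z"
  using cinner_add_left[of "x - y" y z] by simp

lemma cinner_diff_right: "cinner (x::'a::complex_hilbert) (y - z) = cinner x y - cinner x z"
  using cinner_add_right[of x "y - z" z] by simp

lemma cinner_eqI:
  fixes x y :: "'a::complex_hilbert"
  assumes "\<And>z. cinner x z = cinner y z"
  shows "x = y"
proof -
  have "cinner (x - y) (x - y) = 0"
    unfolding cinner_diff_left[of x y] using assms[of "x - y"] by simp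
  then show ?thesis
    by (simp add: cinner_self)
qed

lemma is_adjoint_sym: "is_adjoint s t \<Longrightarrow> is_adjoint t s"
  unfolding is_adjoint_def by (metis cinner_commute)

lemma is_adjoint_norm_le:
  assumes "is_adjoint s t"
  shows "norm s \<le> norm t"
proof (rule norm_blinfun_bound)
  fix \<xi>
  have "complex_of_real ((norm (s \<xi>))\<^sup>2) = cinner \<xi> (t (s \<xi>))"
    using assms cinner_self[of "s \<xi>"] by (simp add: is_adjoint_def)
  then have "(norm (s \<xi>))\<^sup>2 = cmod (cinner \<xi> (t (s \<xi>)))"
    by (metis abs_power2 norm_of_real real_norm_def)
  also have "\<dots> \<le> norm \<xi> * norm (t (s \<xi>))"
    by (rule cinner_cauchy_schwarz)
  also have "\<dots> \<le> norm \<xi> * (norm t * norm (s \<xi>))"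
    by (rule mult_left_mono[OF norm_blinfun norm_ge_zero])
  finally have "norm (s \<xi>) * norm (s \<xi>) \<le> (norm t * norm \<xi>) * norm (s \<xi>)"
    by (simp add: power2_eq_square mult_ac)
  then show "norm (s \<xi>) \<le> norm t * norm \<xi>"
    by (cases "s \<xi> = 0") (simp_all add: mult_le_cancel_right)
qed simp

lemma is_adjoint_norm_eq: "is_adjoint s t \<Longrightarrow> norm s = norm t"
  by (meson antisym is_adjoint_norm_le is_adjoint_sym)

text \<open>Compactness of \<open>t\<close> yields a vector \<open>w\<close> of norm \<open>\<parallel>t\<parallel>\<close> that is a limit of points
  \<open>t \<xi>\<close> with \<open>\<parallel>\<xi>\<parallel> \<le> 1\<close>.  The maximum is thus reached in the closure of the image of the ball,
  which says nothing directly about \<open>t\<close>, but \<open>[s w, \<xi>] = [w, t \<xi>]\<close> tends to \<open>\<parallel>w\<parallel>\<^sup>2\<close>,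
  so the adjoint \<open>s\<close> attains its norm in the direction of \<open>w\<close>.\<close>

lemma adjoint_of_compact_attains_norm:
  assumes adj: "is_adjoint s t" and K: "t \<in> compact_operators" and "t \<noteq> 0"
  obtains h where "norm h = 1" and "norm (s h) = norm s"
proof -
  define C where "C = closure (blinfun_apply t ` cball 0 1)"
  have img: "t \<xi> \<in> C" if "norm \<xi> \<le> 1" for \<xi>
    using that closure_subset by (fastforce simp: C_def)
  have "compact C" using K by (simp add: compact_operators_def C_def)
  moreover have "C \<noteq> {}" using img[of 0] by auto
  moreover have "continuous_on C norm" by (intro continuous_intros)
  ultimately obtain w where w: "w \<in> C" and max: "\<And>u. u \<in> C \<Longrightarrow> norm u \<le> norm w"
    using continuous_attains_sup[of C norm] by auto
  have tw: "norm t \<le> norm w"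
  proof (rule norm_blinfun_bound)
    fix \<xi>
    show "norm (t \<xi>) \<le> norm w * norm \<xi>"
    proof (cases "\<xi> = 0")
      case False
      have "norm (t ((1 / norm \<xi>) *\<^sub>R \<xi>)) \<le> norm w"
        using False by (intro max img) simp
      then show ?thesis
        using False by (simp add: blinfun.scaleR_right field_simps)
    qed (simp add: blinfun.zero_right)
  qed simp
  have "w \<noteq> 0" using tw \<open>t \<noteq> 0\<close> by auto
  have "norm w * norm w \<le> norm (s w)"
  proof (rule field_le_epsilon)
    fix e :: real assume "e > 0"
    define d where "d = e / norm w"
    have "d > 0" using \<open>e > 0\<close> \<open>w \<noteq> 0\<close> by (simp add: d_def)
    then obtain \<xi> where \<xi>: "norm \<xi> \<le> 1" "dist (t \<xi>) w < d"
      using w by (auto simp: C_def closure_approachable)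
    have "complex_of_real (norm w * norm w) = cinner w (t \<xi>) + cinner w (w - t \<xi>)"
      by (simp add: cinner_diff_right cinner_self power2_eq_square)
    then have "norm w * norm w = cmod (cinner w (t \<xi>) + cinner w (w - t \<xi>))"
      by (metis abs_mult_self_eq abs_mult norm_of_real)
    also have "\<dots> \<le> cmod (cinner (s w) \<xi>) + cmod (cinner w (w - t \<xi>))"
      using adj by (simp add: is_adjoint_def norm_triangle_ineq)
    also have "\<dots> \<le> norm (s w) * norm \<xi> + norm w * norm (w - t \<xi>)"
      by (intro add_mono cinner_cauchy_schwarz)
    also have "\<dots> \<le> norm (s w) * 1 + norm w * d"
      using \<xi> by (intro add_mono mult_left_mono) (auto simp: dist_norm norm_minus_commute)
    finally show "norm w * norm w \<le> norm (s w) + e"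
      using \<open>w \<noteq> 0\<close> by (simp add: d_def)
  qed
  then have "norm w \<le> norm (s ((1 / norm w) *\<^sub>R w))"
    using \<open>w \<noteq> 0\<close> by (simp add: blinfun.scaleR_right field_simps)
  moreover have "norm (s ((1 / norm w) *\<^sub>R w)) \<le> norm s"
    using norm_blinfun[of s "(1 / norm w) *\<^sub>R w"] \<open>w \<noteq> 0\<close> by simp
  ultimately have "norm (s ((1 / norm w) *\<^sub>R w)) = norm s"
    using tw is_adjoint_norm_eq[OF adj] by linarith
  then show thesis
    using that[of "(1 / norm w) *\<^sub>R w"] \<open>w \<noteq> 0\<close> by simp
qed

lemma rank_one_bounded: "rank_one \<xi> \<eta> \<in> bounded_operators"
  by (simp add: bounded_operators_def cinner_scaleC_left scaleC_scaleC)

lemma bounded_linear_scaleC_left: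
  "bounded_linear (\<lambda>a. a *\<^sub>C (x :: 'a::complex_normed_vector))"
proof (rule bounded_linear_intro[where K = "norm x"])
  show "(r *\<^sub>R a) *\<^sub>C x = r *\<^sub>R (a *\<^sub>C x)" for r a
    by (simp add: scaleR_scaleC scaleC_scaleC scaleR_conv_of_real)
qed (simp_all add: scaleC_add_left norm_scaleC)

lemma rank_one_compact: "rank_one \<xi> \<eta> \<in> compact_operators"
proof -
  let ?D = "(\<lambda>a. a *\<^sub>C \<xi>) ` cball 0 (norm \<eta>)"
  have "compact ?D"
    by (intro compact_continuous_image linear_continuous_on bounded_linear_scaleC_left
        compact_cball)
  moreover have "blinfun_apply (rank_one \<xi> \<eta>) ` cball 0 1 \<subseteq> ?D"
  proof
    fix u assume "u \<in> blinfun_apply (rank_one \<xi> \<eta>) ` cball 0 1"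
    then obtain \<nu> where "norm \<nu> \<le> 1" and u: "u = cinner \<nu> \<eta> *\<^sub>C \<xi>" by auto
    then have "cmod (cinner \<nu> \<eta>) \<le> norm \<eta>"
      using cinner_cauchy_schwarz[of \<nu> \<eta>] mult_right_mono[of "norm \<nu>" 1 "norm \<eta>"] by simp
    then show "u \<in> ?D" using u by auto
  qed
  ultimately have "closure (blinfun_apply (rank_one \<xi> \<eta>) ` cball 0 1) \<subseteq> ?D"
    by (intro closure_minimal compact_imp_closed)
  then have "compact (closure (blinfun_apply (rank_one \<xi> \<eta>) ` cball 0 1))"
    by (metis Int_absorb1 \<open>compact ?D\<close> closed_closure compact_Int_closed)
  then show ?thesis
    by (simp add: compact_operators_def rank_one_bounded)
qed

lemma rank_one_self_adjoint: "is_adjoint (rank_one h h) (rank_one h h)"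
  using cinner_commute by (auto simp: is_adjoint_def cinner_scaleC_left cinner_scaleC_right)

lemma rank_one_minimal_projection:
  assumes h: "norm h = 1"
  shows "minimal_projection (rank_one h h)"
proof -
  let ?e = "rank_one h h"
  have hh: "cinner h h = 1" using h by (simp add: cinner_self)
  have idem: "?e o\<^sub>L ?e = ?e"
    by (rule blinfun_eqI) (simp add: cinner_scaleC_left hh)
  have "?e h \<noteq> 0" using h by (auto simp: hh scaleC_one)
  then have "?e \<noteq> 0" by (metis zero_blinfun.rep_eq)
  have corner: "?e o\<^sub>L t o\<^sub>L ?e = cinner (t h) h *\<^sub>C ?e" if "t \<in> bounded_operators" for t
    using that
    by (intro blinfun_eqI)
      (simp add: bounded_operators_def scaleC_blinfun.rep_eq cinner_scaleC_left scaleC_scaleC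
        mult.commute)
  have scaled: "a *\<^sub>C ?e \<in> bounded_operators" for a
    by (simp add: bounded_operators_def scaleC_blinfun.rep_eq cinner_scaleC_left scaleC_scaleC
        mult_ac)
  have "{?e o\<^sub>L t o\<^sub>L ?e | t. t \<in> bounded_operators} = range (\<lambda>a. a *\<^sub>C ?e)"
  proof
    show "{?e o\<^sub>L t o\<^sub>L ?e | t. t \<in> bounded_operators} \<subseteq> range (\<lambda>a. a *\<^sub>C ?e)"
      using corner by auto
    have "a *\<^sub>C ?e = ?e o\<^sub>L (a *\<^sub>C ?e) o\<^sub>L ?e" for a
      using corner[OF scaled[of a]] by (simp add: scaleC_blinfun.rep_eq cinner_scaleC_left hh)
    then show "range (\<lambda>a. a *\<^sub>C ?e) \<subseteq> {?e o\<^sub>L t o\<^sub>L ?e | t. t \<in> bounded_operators}"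
      using scaled by blast
  qed
  then show ?thesis
    using idem \<open>?e \<noteq> 0\<close>
    by (simp add: minimal_projection_def rank_one_compact rank_one_self_adjoint)
qed

context hilbert_module
begin

section \<open>Vector forms of the inner product\<close>

lemma ip_scaleC_vector: "ip x y (a *\<^sub>C \<xi>) = a *\<^sub>C ip x y \<xi>"
  using ip_compact[of x y] by (simp add: compact_operators_def bounded_operators_def)

lemma cinner_ip: "cinner (ip x y \<xi>) \<eta> = cinner \<xi> (ip y x \<eta>)"
  using ip_adjoint[of x y] by (simp add: is_adjoint_def)

lemma norm_ip_commute: "norm (ip x y) = norm (ip y x)"
  by (rule is_adjoint_norm_eq[OF ip_adjoint])

lemma ip_act_right:
  assumes K: "t \<in> compact_operators" and adj: "is_adjoint s t"
  shows "ip x (act t y) \<nu> = ip x y (s \<nu>)"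
proof (rule cinner_eqI)
  fix \<eta>
  have "cinner (ip x (act t y) \<nu>) \<eta> = cinner \<nu> (t (ip y x \<eta>))"
    by (simp add: cinner_ip ip_act_left K)
  also have "\<dots> = cinner (ip x y (s \<nu>)) \<eta>"
    using adj by (simp add: is_adjoint_def cinner_ip)
  finally show "cinner (ip x (act t y) \<nu>) \<eta> = cinner (ip x y (s \<nu>)) \<eta>" .
qed

text \<open>For a fixed vector \<open>\<nu>\<close> the scalar function \<open>(u, w) \<mapsto> [\<langle>u, w\<rangle>\<nu>, \<nu>]\<close> is a semi-inner product
  on the module.  It turns inequalities between operators into inequalities between numbers.\<close>

lemma vector_form_cauchy_schwarz:
  "(cmod (cinner (ip u w \<nu>) \<nu>))\<^sup>2 \<le> Re (cinner (ip u u \<nu>) \<nu>) * Re (cinner (ip w w \<nu>) \<nu>)"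
proof (rule semi_inner_cauchy_schwarz[where B = "\<lambda>u w. cinner (ip u w \<nu>) \<nu>"])
  fix u w z :: 'e and a :: complex
  show "cinner (ip u w \<nu>) \<nu> = cnj (cinner (ip w u \<nu>) \<nu>)"
    by (metis cinner_commute cinner_ip)
  show "cinner (ip (u + w) z \<nu>) \<nu> = cinner (ip u z \<nu>) \<nu> + cinner (ip w z \<nu>) \<nu>"
    by (simp add: ip_add_left blinfun.add_left cinner_add_left)
  show "cinner (ip (a *\<^sub>C u) w \<nu>) \<nu> = a * cinner (ip u w \<nu>) \<nu>"
    by (simp add: ip_scaleC_left scaleC_blinfun.rep_eq cinner_scaleC_left)
  show "0 \<le> Re (cinner (ip u u \<nu>) \<nu>)"
    using ip_positive[of u] by (simp add: positive_operator_def)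
qed

lemma vector_form_act:
  assumes "s \<in> compact_operators" "is_adjoint s' s" "t \<in> compact_operators" "is_adjoint t' t"
  shows "cinner (ip (act s x) (act t y) \<nu>) \<nu> = cinner (ip x y (t' \<nu>)) (s' \<nu>)"
proof -
  have "cinner (ip (act s x) (act t y) \<nu>) \<nu> = cinner (s (ip x y (t' \<nu>))) \<nu>"
    using assms by (simp add: ip_act_left ip_act_right[where s = t'])
  also have "\<dots> = cinner (ip x y (t' \<nu>)) (s' \<nu>)"
    using is_adjoint_sym[OF assms(2)] by (simp add: is_adjoint_def)
  finally show ?thesis .
qed

text \<open>This is the operator inequality \<open>\<langle>x, y\<rangle>\<^sup>*\<langle>x, y\<rangle> \<le> \<parallel>x\<parallel>\<^sup>2 \<langle>y, y\<rangle>\<close>.  With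
  \<open>\<eta> = \<langle>x, y\<rangle>\<nu>\<close> it comes from Cauchy--Schwarz for the form at \<open>\<nu>\<close> and the pair
  \<open>\<langle>y, x\<rangle>x, y\<close>: their product is \<open>\<parallel>\<eta>\<parallel>\<^sup>2\<close>, and the form of \<open>\<langle>y, x\<rangle>x\<close> at \<open>\<nu>\<close> is that
  of \<open>x\<close> at \<open>\<eta>\<close>, so that one factor \<open>\<parallel>\<eta>\<parallel>\<^sup>2\<close> cancels.\<close>

lemma norm_ip_apply_le: "(norm (ip x y \<nu>))\<^sup>2 \<le> (norm x)\<^sup>2 * Re (cinner (ip y y \<nu>) \<nu>)"
proof -
  let ?\<eta> = "ip x y \<nu>"
  let ?u = "act (ip y x) x"
  have nonneg: "0 \<le> Re (cinner (ip y y \<nu>) \<nu>)"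
    using ip_positive[of y] by (simp add: positive_operator_def)
  have lhs: "cinner (ip ?u y \<nu>) \<nu> = complex_of_real ((norm ?\<eta>)\<^sup>2)"
    by (simp add: ip_act_left ip_compact cinner_ip[of y x] cinner_self)
  have "Re (cinner (ip ?u ?u \<nu>) \<nu>) \<le> (norm x)\<^sup>2 * (norm ?\<eta>)\<^sup>2"
    using ip_quadratic_bound[of x ?\<eta>]
    by (simp add: vector_form_act[OF ip_compact ip_adjoint ip_compact ip_adjoint])
  then have "((norm ?\<eta>)\<^sup>2)\<^sup>2 \<le> ((norm x)\<^sup>2 * (norm ?\<eta>)\<^sup>2) * Re (cinner (ip y y \<nu>) \<nu>)"
    using vector_form_cauchy_schwarz[of ?u y \<nu>] nonneg unfolding lhs norm_of_real abs_power2
    by (meson mult_right_mono order_trans)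
  then have "(norm ?\<eta>)\<^sup>2 * (norm ?\<eta>)\<^sup>2 \<le> (norm ?\<eta>)\<^sup>2 * ((norm x)\<^sup>2 * Re (cinner (ip y y \<nu>) \<nu>))"
    by (simp add: power2_eq_square mult_ac)
  then show ?thesis
    using nonneg by (cases "?\<eta> = 0") (simp, simp only: mult_le_cancel_left_pos
      zero_less_power zero_less_norm_iff not_False_eq_True)
qed

text \<open>A positive operator is bounded by the supremum of its quadratic form; applied to \<open>\<langle>u, u\<rangle>\<close>
  this lets norm estimates in the module be checked one vector \<open>\<nu>\<close> at a time.\<close>

lemma norm_le_if_vector_forms_le:
  assumes "k \<ge> 0" and form: "\<And>\<nu>. Re (cinner (ip u u \<nu>) \<nu>) \<le> (k * norm \<nu>)\<^sup>2"
  shows "norm u \<le> k"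
proof -
  have "norm (ip u u) \<le> norm u * k"
  proof (rule norm_blinfun_bound)
    fix \<nu>
    have "(norm (ip u u \<nu>))\<^sup>2 \<le> (norm u)\<^sup>2 * (k * norm \<nu>)\<^sup>2"
      using norm_ip_apply_le[of u u \<nu>] mult_left_mono[OF form[of \<nu>], of "(norm u)\<^sup>2"] by simp
    then have "(norm (ip u u \<nu>))\<^sup>2 \<le> (norm u * k * norm \<nu>)\<^sup>2"
      by (simp add: power_mult_distrib mult.assoc)
    then show "norm (ip u u \<nu>) \<le> norm u * k * norm \<nu>"
      by (rule power2_le_imp_le) (simp add: \<open>k \<ge> 0\<close>)
  qed (simp add: \<open>k \<ge> 0\<close>)
  then have "norm u * norm u \<le> norm u * k"
    by (simp add: power2_eq_square flip: norm_power2)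
  then show ?thesis
    using \<open>k \<ge> 0\<close> by (cases "u = 0") simp_all
qed

section \<open>Norms of sums of the operators theta\<close>

lemma norm_theta_self: "norm (theta act ip x x) = (norm x)\<^sup>2"
proof (rule antisym)
  show "norm (theta act ip x x) \<le> (norm x)\<^sup>2"
  proof (rule norm_blinfun_bound)
    fix z
    have "norm (act (ip z x) x) \<le> norm (ip z x) * norm x"
      by (rule norm_act_le[OF ip_compact])
    also have "\<dots> \<le> (norm z * norm x) * norm x"
      by (rule mult_right_mono[OF norm_ip_le norm_ge_zero])
    finally show "norm (theta act ip x x z) \<le> (norm x)\<^sup>2 * norm z"
      by (simp add: theta_apply power2_eq_square mult_ac)
  qed simp
  show "(norm x)\<^sup>2 \<le> norm (theta act ip x x)"
  proof (cases "x = 0")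
    case False
    let ?N = "norm (theta act ip x x)"
    have "norm (ip x x) \<le> sqrt (?N * (norm x)\<^sup>2)"
    proof (rule norm_blinfun_bound)
      fix \<nu>
      \<comment> \<open>\<open>\<langle>x, x\<rangle>\<^sup>2 = \<langle>\<theta> x, x\<rangle>\<close>, and the form of \<open>\<langle>x, x\<rangle>\<^sup>2\<close> at \<open>\<nu>\<close> is \<open>\<parallel>\<langle>x, x\<rangle>\<nu>\<parallel>\<^sup>2\<close>\<close>
      have "complex_of_real ((norm (ip x x \<nu>))\<^sup>2) = cinner (ip (theta act ip x x x) x \<nu>) \<nu>"
        using cinner_self[of "ip x x \<nu>"]
        by (simp add: theta_apply ip_act_left ip_compact cinner_ip)
      then have "(norm (ip x x \<nu>))\<^sup>2 = cmod (cinner (ip (theta act ip x x x) x \<nu>) \<nu>)"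
        by (metis abs_power2 norm_of_real)
      also have "\<dots> \<le> norm (ip (theta act ip x x x) x \<nu>) * norm \<nu>"
        by (rule cinner_cauchy_schwarz)
      also have "\<dots> \<le> (norm (ip (theta act ip x x x) x) * norm \<nu>) * norm \<nu>"
        by (rule mult_right_mono[OF norm_blinfun norm_ge_zero])
      also have "\<dots> \<le> (?N * norm x * norm x) * norm \<nu> * norm \<nu>"
        by (intro mult_right_mono order_trans[OF norm_ip_le] norm_blinfun norm_ge_zero)
      finally have "(norm (ip x x \<nu>))\<^sup>2 \<le> (sqrt (?N * (norm x)\<^sup>2) * norm \<nu>)\<^sup>2"
        by (simp add: power_mult_distrib power2_eq_square mult_ac)
      then show "norm (ip x x \<nu>) \<le> sqrt (?N * (norm x)\<^sup>2) * norm \<nu>"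
        by (rule power2_le_imp_le) simp
    qed simp
    then have "((norm x)\<^sup>2)\<^sup>2 \<le> ?N * (norm x)\<^sup>2"
      unfolding norm_power2[symmetric]
      using power_mono[of "(norm x)\<^sup>2" "sqrt (?N * (norm x)\<^sup>2)" 2] by simp
    then show ?thesis
      using False by (simp add: power2_eq_square)
  qed simp
qed

text \<open>The operator \<open>\<theta>\<^bsub>x,x\<^esub> + \<mu> \<theta>\<^bsub>y,y\<^esub>\<close> factors through the row \<open>(x, y)\<close>, whose Gram matrix
  has operator entries of norms at most \<open>a = \<parallel>x\<parallel>\<^sup>2\<close>, \<open>b = \<parallel>y\<parallel>\<^sup>2\<close> on and \<open>c\<close> off the diagonal.
  Any number \<open>l\<close> that dominates the numerical matrix with these entries bounds the square of the
  norm of the row, and hence the product of the row, the diagonal matrix of phases \<open>1, \<mu>\<close> and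
  the adjoint of the row.  At the level of forms: with \<open>P = \<parallel>\<langle>x, z\<rangle>\<nu>\<parallel>\<close>
  and \<open>Q = \<parallel>\<langle>y, z\<rangle>\<nu>\<parallel>\<close> the form of the image of \<open>z\<close> is at most \<open>l (P\<^sup>2 + Q\<^sup>2)\<close> for every
  phase \<open>\<mu>\<close>, while for \<open>\<mu> = 1\<close> pairing that image with \<open>z\<close> returns \<open>P\<^sup>2 + Q\<^sup>2\<close>, so that
  \<open>P\<^sup>2 + Q\<^sup>2\<close> is itself at most \<open>l\<close> times the form of \<open>z\<close>.\<close>

lemma norm_theta_sum_le:
  assumes l: "l \<ge> 0" and \<mu>: "cmod \<mu> = 1"
    and dom: "\<And>P Q. P \<ge> 0 \<Longrightarrow> Q \<ge> 0 \<Longrightarrow>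
      (norm x)\<^sup>2 * P\<^sup>2 + 2 * norm (ip x y) * P * Q + (norm y)\<^sup>2 * Q\<^sup>2 \<le> l * (P\<^sup>2 + Q\<^sup>2)"
  shows "norm (theta act ip x x + \<mu> *\<^sub>C theta act ip y y) \<le> l"
proof (rule norm_blinfun_bound[OF l])
  fix z
  define w where "w \<kappa> = act (ip z x) x + \<kappa> *\<^sub>C act (ip z y) y" for \<kappa>
  have "norm (w \<mu>) \<le> l * norm z"
  proof (rule norm_le_if_vector_forms_le)
    fix \<nu>
    define p q where "p = ip x z \<nu>" and "q = ip y z \<nu>"
    define S F where "S = (norm p)\<^sup>2 + (norm q)\<^sup>2" and "F = Re (cinner (ip z z \<nu>) \<nu>)"
    have S0: "S \<ge> 0" and F0: "F \<ge> 0"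
      using ip_positive[of z] by (auto simp: S_def F_def positive_operator_def)
    have row: "Re (cinner (ip (w \<kappa>) (w \<kappa>) \<nu>) \<nu>) \<le> l * S" if \<kappa>: "cmod \<kappa> = 1" for \<kappa>
    proof -
      have \<kappa>\<kappa>: "\<kappa> * cnj \<kappa> = 1"
        using \<kappa> by (simp flip: complex_norm_square)
      have "cinner (ip (w \<kappa>) (w \<kappa>) \<nu>) \<nu> = cinner (ip x x p) p + cnj \<kappa> * cinner (ip x y q) p
          + (\<kappa> * cinner (ip y x p) q + (\<kappa> * cnj \<kappa>) * cinner (ip y y q) q)"
        by (simp add: w_def p_def q_def ip_add_left ip_add_right ip_scaleC_left ip_scaleC_right
            blinfun.add_left scaleC_blinfun.rep_eq cinner_add_left cinner_scaleC_left
            vector_form_act[OF ip_compact ip_adjoint ip_compact ip_adjoint] algebra_simps)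
      moreover have "Re (cinner (ip x x p) p) \<le> (norm x)\<^sup>2 * (norm p)\<^sup>2"
        and "Re (cinner (ip y y q) q) \<le> (norm y)\<^sup>2 * (norm q)\<^sup>2"
        by (rule ip_quadratic_bound)+
      moreover have cross: "Re (\<alpha> * cinner (ip u v \<xi>) \<eta>) \<le> norm (ip u v) * norm \<xi> * norm \<eta>"
        if "cmod \<alpha> = 1" for \<alpha> u v \<xi> \<eta>
      proof -
        have "Re (\<alpha> * cinner (ip u v \<xi>) \<eta>) \<le> cmod (cinner (ip u v \<xi>) \<eta>)"
          using complex_Re_le_cmod[of "\<alpha> * cinner (ip u v \<xi>) \<eta>"] that by (simp add: norm_mult)
        also have "\<dots> \<le> norm (ip u v \<xi>) * norm \<eta>"
          by (rule cinner_cauchy_schwarz)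
        also have "\<dots> \<le> norm (ip u v) * norm \<xi> * norm \<eta>"
          by (rule mult_right_mono[OF norm_blinfun norm_ge_zero])
        finally show ?thesis .
      qed
      have "Re (cnj \<kappa> * cinner (ip x y q) p) \<le> norm (ip x y) * norm p * norm q"
        and "Re (\<kappa> * cinner (ip y x p) q) \<le> norm (ip x y) * norm p * norm q"
        using cross[of "cnj \<kappa>" x y q p] cross[of \<kappa> y x p q] \<kappa>
        by (simp_all add: norm_ip_commute[of y x] mult_ac)
      ultimately have "Re (cinner (ip (w \<kappa>) (w \<kappa>) \<nu>) \<nu>)
          \<le> (norm x)\<^sup>2 * (norm p)\<^sup>2 + 2 * norm (ip x y) * norm p * norm q
            + (norm y)\<^sup>2 * (norm q)\<^sup>2"
        unfolding \<kappa>\<kappa> by simp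
      also have "\<dots> \<le> l * S"
        unfolding S_def by (rule dom) simp_all
      finally show ?thesis .
    qed
    have "cinner (ip (w 1) z \<nu>) \<nu> = complex_of_real S"
      by (simp add: w_def p_def q_def S_def scaleC_one ip_add_left ip_act_left ip_compact
          blinfun.add_left cinner_add_left cinner_ip[of z] cinner_self)
    then have "S\<^sup>2 \<le> Re (cinner (ip (w 1) (w 1) \<nu>) \<nu>) * F"
      using vector_form_cauchy_schwarz[of "w 1" z \<nu>] by (simp add: F_def)
    also have "\<dots> \<le> l * S * F"
      by (intro mult_right_mono row F0) simp
    finally have "S * S \<le> S * (l * F)"
      by (simp add: power2_eq_square mult_ac)
    then have "S \<le> l * F"
      using S0 F0 l by (cases "S = 0") simp_all
    also have "\<dots> \<le> l * ((norm z)\<^sup>2 * (norm \<nu>)\<^sup>2)"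
      unfolding F_def by (rule mult_left_mono[OF ip_quadratic_bound l])
    finally have "l * S \<le> l * (l * ((norm z)\<^sup>2 * (norm \<nu>)\<^sup>2))"
      by (rule mult_left_mono[OF _ l])
    then have "l * S \<le> (l * norm z * norm \<nu>)\<^sup>2"
      by (simp add: power_mult_distrib power2_eq_square[of l] mult.assoc)
    then show "Re (cinner (ip (w \<mu>) (w \<mu>) \<nu>) \<nu>) \<le> (l * norm z * norm \<nu>)\<^sup>2"
      using row[OF \<mu>] by linarith
  qed (simp add: l)
  then show "norm ((theta act ip x x + \<mu> *\<^sub>C theta act ip y y) z) \<le> l * norm z"
    by (simp add: w_def blinfun.add_left scaleC_blinfun.rep_eq theta_apply)
qed

text \<open>If the number \<open>c = \<parallel>\<langle>x, y\<rangle>\<parallel>\<close> is smaller than \<open>\<parallel>x\<parallel>\<parallel>y\<parallel>\<close>, then the matrix with diagonal \<open>a, b\<close> and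
  off-diagonal entry \<open>c\<close> has positive determinant, so its largest eigenvalue is smaller than its
  trace \<open>a + b\<close>, and the triangle inequality for the two operators is strict.\<close>

lemma norm_ip_eq_if_theta_parallel:
  assumes "norm_parallel (theta act ip x x) (theta act ip y y)"
  shows "norm (ip x y) = norm x * norm y"
proof (rule ccontr)
  assume "norm (ip x y) \<noteq> norm x * norm y"
  then have less: "norm (ip x y) < norm x * norm y"
    using norm_ip_le[of x y] by simp
  obtain \<mu> where \<mu>: "cmod \<mu> = 1"
    and sum: "norm (theta act ip x x + \<mu> *\<^sub>C theta act ip y y) = (norm x)\<^sup>2 + (norm y)\<^sup>2"
    using assms by (auto simp: norm_parallel_def norm_theta_self)
  define a b c where "a = (norm x)\<^sup>2" and "b = (norm y)\<^sup>2" and "c = norm (ip x y)"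
  have "x \<noteq> 0" using less by auto
  then have ab: "a > 0" "b \<ge> 0" and c: "c \<ge> 0" by (simp_all add: a_def b_def c_def)
  have "c\<^sup>2 < a * b"
    using power_strict_mono[OF less, of 2] by (simp add: a_def b_def c_def power_mult_distrib)
  \<comment> \<open>\<open>a + b - e\<close> is a convenient rational upper bound for the largest eigenvalue: with this \<open>e\<close>
    the matrix with diagonal \<open>b - e, a - e\<close> and off-diagonal entry \<open>- c\<close> has determinant \<open>e\<^sup>2\<close>\<close>
  define e where "e = (a * b - c\<^sup>2) / (a + b)"
  have e: "e > 0" using \<open>c\<^sup>2 < a * b\<close> ab by (simp add: e_def)
  have ae: "a - e = (a\<^sup>2 + c\<^sup>2) / (a + b)" and be: "b - e = (b\<^sup>2 + c\<^sup>2) / (a + b)"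
    using ab by (simp_all add: e_def field_simps power2_eq_square)
  have ae0: "a - e \<ge> 0" and be0: "b - e \<ge> 0"
    unfolding ae be using ab by simp_all
  have "e * (a + b) = a * b - c\<^sup>2" using ab by (simp add: e_def)
  then have det: "c\<^sup>2 \<le> (a - e) * (b - e)"
    by (simp add: power2_eq_square algebra_simps)
  have "norm (theta act ip x x + \<mu> *\<^sub>C theta act ip y y) \<le> a + b - e"
  proof (rule norm_theta_sum_le[OF _ \<mu>])
    fix P Q :: real assume PQ: "P \<ge> 0" "Q \<ge> 0"
    have "c \<le> sqrt (a - e) * sqrt (b - e)"
      using real_le_rsqrt[OF det] by (simp only: real_sqrt_mult)
    then have "2 * c * (P * Q) \<le> 2 * (sqrt (a - e) * sqrt (b - e)) * (P * Q)"
      using PQ by (intro mult_right_mono) simp_all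
    moreover have "0 \<le> (sqrt (b - e) * P - sqrt (a - e) * Q)\<^sup>2" by simp
    then have "2 * (sqrt (a - e) * sqrt (b - e)) * (P * Q) \<le> (b - e) * P\<^sup>2 + (a - e) * Q\<^sup>2"
      using ae0 be0 by (simp add: power2_diff power_mult_distrib mult_ac)
    ultimately have "2 * c * (P * Q) \<le> (b - e) * P\<^sup>2 + (a - e) * Q\<^sup>2" by linarith
    then show "(norm x)\<^sup>2 * P\<^sup>2 + 2 * norm (ip x y) * P * Q + (norm y)\<^sup>2 * Q\<^sup>2
        \<le> (a + b - e) * (P\<^sup>2 + Q\<^sup>2)"
      by (simp add: a_def[symmetric] b_def[symmetric] c_def[symmetric] algebra_simps)
  qed (use ae0 ab in linarith)
  then show False
    using sum e by (simp add: a_def b_def)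
qed

section \<open>Basic vectors adapted to a pair\<close>

text \<open>A unit vector \<open>h\<close> at which \<open>\<langle>x, y\<rangle>\<close> attains the norm \<open>\<parallel>x\<parallel>\<parallel>y\<parallel>\<close> is forced to be an
  eigenvector of \<open>\<langle>y, y\<rangle>\<close> for its top eigenvalue \<open>\<parallel>y\<parallel>\<^sup>2\<close>.  Cutting \<open>y\<close> down by the
  projection onto \<open>h\<close> and normalising gives the basic vector.\<close>

lemma adapted_basic_vector:
  assumes "x \<noteq> 0" "y \<noteq> 0" and eq: "norm (ip x y) = norm x * norm y"
  obtains v h where "norm h = 1" "ip v v = rank_one h h"
    "ip y v h = complex_of_real (norm y) *\<^sub>C h"
    "ip x y h = complex_of_real (norm y) *\<^sub>C ip x v h"
    "norm (ip x v h) = norm x"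
proof -
  define n where "n = norm y"
  have n: "n > 0" using \<open>y \<noteq> 0\<close> by (simp add: n_def)
  have "ip y x \<noteq> 0"
    using eq assms(1,2) norm_ip_commute[of x y] by auto
  then obtain h where h: "norm h = 1" and "norm (ip x y h) = norm (ip x y)"
    by (rule adjoint_of_compact_attains_norm[OF ip_adjoint ip_compact])
  then have nh: "norm (ip x y h) = norm x * n" by (simp add: eq n_def)
  have hh: "cinner h h = 1" using h by (simp add: cinner_self)
  have "(norm x)\<^sup>2 * n\<^sup>2 \<le> (norm x)\<^sup>2 * Re (cinner (ip y y h) h)"
    using norm_ip_apply_le[of x y h] by (simp add: nh power_mult_distrib)
  then have top: "n\<^sup>2 \<le> Re (cinner (ip y y h) h)" using \<open>x \<noteq> 0\<close> by simp
  \<comment> \<open>expand \<open>\<parallel>\<langle>y, y\<rangle>h - n\<^sup>2 h\<parallel>\<^sup>2\<close>; the bounds \<open>\<parallel>\<langle>y, y\<rangle>h\<parallel> \<le> n\<^sup>2 \<le> [\<langle>y, y\<rangle>h, h]\<close> leave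
    nothing positive\<close>
  have eig: "ip y y h = complex_of_real (n\<^sup>2) *\<^sub>C h"
  proof -
    let ?k = "complex_of_real (n\<^sup>2)"
    have real: "cnj (cinner (ip y y h) h) = cinner (ip y y h) h"
      by (metis cinner_commute cinner_ip)
    have "cinner (ip y y h - ?k *\<^sub>C h) (ip y y h - ?k *\<^sub>C h)
        = complex_of_real ((norm (ip y y h))\<^sup>2) - 2 * ?k * cinner (ip y y h) h + ?k * ?k"
      using cinner_commute[of h "ip y y h"] real cinner_self[of "ip y y h"]
      by (simp add: cinner_diff_left cinner_diff_right cinner_scaleC_left cinner_scaleC_right hh
          algebra_simps)
    then have "complex_of_real ((norm (ip y y h - ?k *\<^sub>C h))\<^sup>2)
        = complex_of_real ((norm (ip y y h))\<^sup>2) - 2 * ?k * cinner (ip y y h) h + ?k * ?k"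
      by (simp only: cinner_self)
    then have "(norm (ip y y h - ?k *\<^sub>C h))\<^sup>2
        = (norm (ip y y h))\<^sup>2 - 2 * n\<^sup>2 * Re (cinner (ip y y h) h) + n\<^sup>2 * n\<^sup>2"
      by (auto simp: complex_eq_iff)
    moreover have "norm (ip y y h) \<le> n\<^sup>2"
      using norm_blinfun[of "ip y y" h] h by (simp add: n_def norm_power2)
    then have "(norm (ip y y h))\<^sup>2 \<le> n\<^sup>2 * n\<^sup>2"
      using power_mono[of "norm (ip y y h)" "n\<^sup>2" 2] by (simp add: power2_eq_square)
    moreover have "n\<^sup>2 * n\<^sup>2 \<le> n\<^sup>2 * Re (cinner (ip y y h) h)"
      by (rule mult_left_mono[OF top]) simp
    ultimately have "(norm (ip y y h - ?k *\<^sub>C h))\<^sup>2 \<le> 0" by linarith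
    then show ?thesis by simp
  qed
  let ?e = "rank_one h h"
  define v where "v = complex_of_real (1 / n) *\<^sub>C act ?e y"
  have right: "ip u v \<nu> = complex_of_real (1 / n) *\<^sub>C (cinner \<nu> h *\<^sub>C ip u y h)" for u \<nu>
    by (simp add: v_def ip_scaleC_right scaleC_blinfun.rep_eq ip_scaleC_vector
        ip_act_right[OF rank_one_compact rank_one_self_adjoint])
  have "ip v v = ?e"
  proof (rule blinfun_eqI)
    fix \<nu>
    have "ip v y h = complex_of_real n *\<^sub>C h"
      using n by (simp add: v_def ip_scaleC_left scaleC_blinfun.rep_eq ip_act_left rank_one_compact
          eig cinner_scaleC_left hh scaleC_scaleC power2_eq_square)
    then show "ip v v \<nu> = ?e \<nu>"
      using n by (simp add: right scaleC_scaleC)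
  qed
  moreover have "ip y v h = complex_of_real (norm y) *\<^sub>C h"
    using n by (simp add: right hh eig scaleC_scaleC scaleC_one power2_eq_square n_def)
  moreover have "ip x y h = complex_of_real (norm y) *\<^sub>C ip x v h"
    using n by (simp add: right hh scaleC_scaleC scaleC_one n_def)
  moreover have "norm (ip x v h) = norm x"
    using n by (simp add: right hh scaleC_one norm_scaleC nh norm_divide)
  ultimately show thesis using that h by blast
qed

text \<open>The phase \<open>1\<close> works: on the adapted vector \<open>v\<close> the forms of \<open>\<theta>\<^bsub>x,x\<^esub>\<close> and
  \<open>\<theta>\<^bsub>y,y\<^esub>\<close> at \<open>h\<close> are \<open>\<parallel>\<langle>x, v\<rangle>h\<parallel>\<^sup>2\<close> and \<open>\<parallel>\<langle>y, v\<rangle>h\<parallel>\<^sup>2\<close>, both as large as possible.\<close>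

lemma theta_parallel_if_norm_ip_eq:
  assumes eq: "norm (ip x y) = norm x * norm y"
  shows "norm_parallel (theta act ip x x) (theta act ip y y)"
proof (cases "x = 0 \<or> y = 0")
  case True
  have "theta act ip u u = 0" if "u = 0" for u
    using norm_theta_self[of u] that by simp
  then show ?thesis
    using True by (auto simp: norm_parallel_def norm_scaleC intro!: exI[of _ 1])
next
  case False
  then obtain v h where h: "norm h = 1" and vv: "ip v v = rank_one h h"
    and yv: "ip y v h = complex_of_real (norm y) *\<^sub>C h" and xv: "norm (ip x v h) = norm x"
    using adapted_basic_vector[OF _ _ eq] by blast
  let ?T = "theta act ip x x + 1 *\<^sub>C theta act ip y y"
  have "norm v \<le> 1"
  proof (rule norm_le_if_vector_forms_le)
    fix \<nu>
    have "cinner (ip v v \<nu>) \<nu> = cinner \<nu> h * cnj (cinner \<nu> h)"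
      by (simp add: vv cinner_scaleC_left flip: cinner_commute)
    then have "Re (cinner (ip v v \<nu>) \<nu>) = (cmod (cinner \<nu> h))\<^sup>2"
      by (simp add: complex_mult_cnj cmod_power2)
    also have "\<dots> \<le> (norm \<nu> * norm h)\<^sup>2"
      by (intro power_mono cinner_cauchy_schwarz norm_ge_zero)
    finally show "Re (cinner (ip v v \<nu>) \<nu>) \<le> (1 * norm \<nu>)\<^sup>2"
      by (simp add: h)
  qed simp
  have "norm (ip y v h) = norm y"
    by (simp add: yv norm_scaleC h)
  have "cinner (ip (?T v) v h) h = complex_of_real ((norm (ip x v h))\<^sup>2 + (norm (ip y v h))\<^sup>2)"
    by (simp add: scaleC_one blinfun.add_left theta_apply ip_add_left ip_act_left ip_compact
        cinner_add_left cinner_ip[of v] cinner_self)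
  then have "(norm x)\<^sup>2 + (norm y)\<^sup>2 = cmod (cinner (ip (?T v) v h) h)"
    by (simp add: xv \<open>norm (ip y v h) = norm y\<close> del: of_real_add of_real_power)
  also have "\<dots> \<le> norm (ip (?T v) v h) * norm h"
    by (rule cinner_cauchy_schwarz)
  also have "\<dots> \<le> norm (ip (?T v) v)"
    using norm_blinfun[of "ip (?T v) v" h] by (simp add: h)
  also have "\<dots> \<le> norm ?T * norm v * norm v"
    by (intro order_trans[OF norm_ip_le] mult_right_mono norm_blinfun norm_ge_zero)
  also have "\<dots> \<le> norm ?T * 1 * 1"
    by (intro mult_mono \<open>norm v \<le> 1\<close>) simp_all
  finally have "(norm x)\<^sup>2 + (norm y)\<^sup>2 \<le> norm ?T" by simp
  moreover have "norm ?T \<le> (norm x)\<^sup>2 + (norm y)\<^sup>2"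
    using norm_triangle_ineq[of "theta act ip x x" "1 *\<^sub>C theta act ip y y"]
    by (simp add: norm_scaleC norm_theta_self)
  ultimately show ?thesis
    by (auto simp: norm_parallel_def norm_theta_self intro!: exI[of _ 1])
qed

lemma basic_vector_if_norm_ip_eq:
  assumes "x \<noteq> 0" "y \<noteq> 0" "norm (ip x y) = norm x * norm y"
  obtains v h where "norm h = 1" "basic_vector ip v" "ip v v = rank_one h h"
    "cinner ((ip v x o\<^sub>L ip x y o\<^sub>L ip y v) h) h = complex_of_real ((norm x)\<^sup>2 * (norm y)\<^sup>2)"
proof -
  obtain v h where h: "norm h = 1" and vv: "ip v v = rank_one h h"
    and yv: "ip y v h = complex_of_real (norm y) *\<^sub>C h"
    and xy: "ip x y h = complex_of_real (norm y) *\<^sub>C ip x v h"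
    and xv: "norm (ip x v h) = norm x"
    using adapted_basic_vector[OF assms] .
  have "basic_vector ip v"
    using rank_one_minimal_projection[OF h] by (simp add: basic_vector_def vv)
  moreover have "cinner ((ip v x o\<^sub>L ip x y o\<^sub>L ip y v) h) h
      = complex_of_real ((norm x)\<^sup>2 * (norm y)\<^sup>2)"
    by (simp add: yv ip_scaleC_vector xy cinner_scaleC_left cinner_ip[of v x] cinner_self xv
        power2_eq_square mult_ac)
  ultimately show thesis using that h vv by blast
qed

text \<open>The left side is \<open>[\<langle>x, y\<rangle>\<langle>y, v\<rangle>h, \<langle>x, v\<rangle>h]\<close>, whose modulus is at most
  \<open>\<parallel>\<langle>x, y\<rangle>\<parallel>\<parallel>y\<parallel>\<parallel>x\<parallel>\<close> because \<open>v\<close> and \<open>h\<close> are unit vectors.\<close>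

lemma norm_ip_eq_if_basic_vector:
  assumes h: "norm h = 1" and vv: "ip v v = rank_one h h" and \<mu>: "cmod \<mu> = 1"
    and val: "cinner ((ip v x o\<^sub>L ip x y o\<^sub>L ip y v) h) h
      = \<mu> * complex_of_real ((norm x)\<^sup>2 * (norm y)\<^sup>2)"
  shows "norm (ip x y) = norm x * norm y"
proof (rule antisym[OF norm_ip_le])
  have "norm (ip v v) \<le> 1"
    using h cinner_cauchy_schwarz[of _ h]
    by (intro norm_blinfun_bound) (auto simp: vv norm_scaleC)
  then have v: "norm v \<le> 1"
    by (simp add: norm_eq_sqrt_ip)
  have yv: "norm (ip y v h) \<le> norm y" and xv: "norm (ip x v h) \<le> norm x"
    using norm_blinfun[of "ip y v" h] norm_ip_le[of y v] norm_blinfun[of "ip x v" h]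
      norm_ip_le[of x v] mult_left_mono[OF v norm_ge_zero[of y]]
      mult_left_mono[OF v norm_ge_zero[of x]]
    by (simp_all add: h)
  have "(norm x)\<^sup>2 * (norm y)\<^sup>2 = cmod (cinner ((ip v x o\<^sub>L ip x y o\<^sub>L ip y v) h) h)"
    unfolding val by (simp add: norm_mult \<mu> norm_power)
  also have "\<dots> = cmod (cinner (ip x y (ip y v h)) (ip x v h))"
    by (simp add: cinner_ip[of v x])
  also have "\<dots> \<le> norm (ip x y (ip y v h)) * norm (ip x v h)"
    by (rule cinner_cauchy_schwarz)
  also have "\<dots> \<le> (norm (ip x y) * norm y) * norm x"
    by (intro mult_mono order_trans[OF norm_blinfun] xv yv order_refl) simp_all
  finally have "(norm x * norm y) * (norm x * norm y) \<le> norm (ip x y) * (norm x * norm y)"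
    by (simp add: power2_eq_square mult_ac)
  then show "norm x * norm y \<le> norm (ip x y)"
    by (cases "norm x * norm y = 0") (auto simp: mult_le_cancel_right)
qed

lemma full_module_nonzero_vector:
  assumes full: "full_module ip" and "\<exists>\<xi>::'h. \<xi> \<noteq> 0"
  obtains w :: 'e where "w \<noteq> 0"
proof (rule ccontr)
  assume "\<not> thesis"
  then have "ip u v = 0" for u v
    using that ip_eq_zero_iff[of u] by (metis)
  then have "{ip u v | u v. True} = {0}" by auto
  moreover have "complex_vector.span {0 :: 'h \<Rightarrow>\<^sub>L 'h} = {0}"
    by simp
  ultimately have "compact_operators \<subseteq> closure {0 :: 'h \<Rightarrow>\<^sub>L 'h}"
    using full by (simp add: full_module_def)
  then have K: "compact_operators \<subseteq> {0 :: 'h \<Rightarrow>\<^sub>L 'h}" by simp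
  \<comment> \<open>but a non-zero Hilbert space carries a non-zero compact operator\<close>
  obtain \<xi> :: 'h where "\<xi> \<noteq> 0" using assms(2) by blast
  then have "rank_one \<xi> \<xi> \<xi> \<noteq> 0"
    by (metis cinner_self norm_eq_zero norm_scaleC mult_eq_0_iff of_real_eq_0_iff
        power_eq_0_iff rank_one_apply)
  moreover have "rank_one \<xi> \<xi> = 0" using K rank_one_compact by blast
  ultimately show False by simp
qed

end

theorem corollary3p11:
  fixes act :: "('h::complex_hilbert \<Rightarrow>\<^sub>L 'h) \<Rightarrow> 'e::{complex_normed_vector, banach} \<Rightarrow> 'e"
    and ip :: "'e \<Rightarrow> 'e \<Rightarrow> ('h \<Rightarrow>\<^sub>L 'h)"
    and x y :: 'e
  assumes nontrivial: "\<exists>\<xi>::'h. \<xi> \<noteq> 0"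
    and finite_dim: "\<exists>B. finite B \<and>
      (compact_operators :: ('h \<Rightarrow>\<^sub>L 'h) set) = complex_vector.span B"
    and module: "hilbert_module act ip"
    and full: "full_module ip"
  shows
    "(norm_parallel (theta act ip x x) (theta act ip y y) \<longleftrightarrow>
      (\<exists>v \<xi> \<mu>. basic_vector ip v \<and> norm \<xi> = 1 \<and> ip v v = rank_one \<xi> \<xi> \<and> cmod \<mu> = 1 \<and>
        cinner ((ip v x o\<^sub>L ip x y o\<^sub>L ip y v) \<xi>) \<xi>
          = \<mu> * complex_of_real ((norm x)\<^sup>2 * (norm y)\<^sup>2))) \<and>
     ((\<exists>v \<xi> \<mu>. basic_vector ip v \<and> norm \<xi> = 1 \<and> ip v v = rank_one \<xi> \<xi> \<and> cmod \<mu> = 1 \<and>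
        cinner ((ip v x o\<^sub>L ip x y o\<^sub>L ip y v) \<xi>) \<xi>
          = \<mu> * complex_of_real ((norm x)\<^sup>2 * (norm y)\<^sup>2)) \<longleftrightarrow>
      norm (ip x y) = norm x * norm y)"
proof -
  interpret hilbert_module act ip by (rule module)
  let ?basic = "\<exists>v \<xi> \<mu>. basic_vector ip v \<and> norm \<xi> = 1 \<and> ip v v = rank_one \<xi> \<xi> \<and> cmod \<mu> = 1 \<and>
        cinner ((ip v x o\<^sub>L ip x y o\<^sub>L ip y v) \<xi>) \<xi>
          = \<mu> * complex_of_real ((norm x)\<^sup>2 * (norm y)\<^sup>2)"
  have "?basic" if eq: "norm (ip x y) = norm x * norm y"
  proof (cases "x = 0 \<or> y = 0")
    case True
    \<comment> \<open>Both sides of the equation vanish, and the existence of some basic vector is what fullness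
      provides: a non-zero \<open>w\<close> satisfies the norm equality for the pair \<open>(w, w)\<close>.\<close>
    obtain w :: 'e where "w \<noteq> 0"
      using full_module_nonzero_vector[OF full nontrivial] .
    moreover have "norm (ip w w) = norm w * norm w"
      using norm_power2[of w] by (simp add: power2_eq_square)
    ultimately obtain v h where "norm h = 1" "basic_vector ip v" "ip v v = rank_one h h"
      by (metis basic_vector_if_norm_ip_eq)
    moreover have "ip x y = 0"
      using True norm_ip_le[of x y] by auto
    ultimately show ?thesis
      using True by (intro exI[of _ v] exI[of _ h] exI[of _ 1]) (auto simp: blinfun.zero_right)
  next
    case False
    then obtain v h where "norm h = 1" "basic_vector ip v" "ip v v = rank_one h h"
      "cinner ((ip v x o\<^sub>L ip x y o\<^sub>L ip y v) h) h = complex_of_real ((norm x)\<^sup>2 * (norm y)\<^sup>2)"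
      using basic_vector_if_norm_ip_eq[OF _ _ eq] by blast
    then show ?thesis
      by (intro exI[of _ v] exI[of _ h] exI[of _ 1]) simp
  qed
  moreover have "norm (ip x y) = norm x * norm y" if ?basic
    using that norm_ip_eq_if_basic_vector by blast
  ultimately show ?thesis
    using norm_ip_eq_if_theta_parallel theta_parallel_if_norm_ip_eq by blast
qed

end
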